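(* Let $X,A,A',A''$ be preordered sets, $R\colon X\to A$, $R'\colon A\to A'$, $R''\colon A'\to A''$ monotone functions, and $\mu\in 2^{X}$. If $A$ is reducible to $A'$ along $R'$ with respect to $R$ and $\mu$, and $A'$ is reducible to $A''$ along $R''$ with respect to $R'\circ R$ and $\mu$, then $A$ is reducible to $A''$ along $R''\circ R'$ with respect to $R$ and $\mu$.
   Context: $2=\{\bot<\top\}$. For a preordered set $X$, $2^{X}$ is the set of monotone functions $X\to 2$ (identified with up-closed subsets), ordered by inclusion. For monotone $R\colon X\to A$, $R^{*}\colon 2^{A}\to 2^{X}$ is $R^{*}\nu=\nu\circ R$. The upper approximation $\overline{R}\colon 2^{X}\to 2^{A}$ is the left adjoint of $R^{*}$ ($\overline{R}\mu\subseteq\nu$ iff $\mu\subseteq R^{*}\nu$), and the lower approximation $\underline{R}$ is the right adjoint of $R^{*}$ ($\nu\subseteq\underline{R}\mu$ iff $R^{*}\nu\subseteq\mu$). Given monotone $S\colon X\to B$ and $\mu\in 2^{X}$, $B$ is reducible to $B'$ along monotone $T\colon B\to B'$ (with respect to $S$ and $\mu$) if $T^{*}(\overline{T\circ S}\,\mu)=\overline{S}\mu$ and $T^{*}(\underline{T\circ S}\,\mu)=\underline{S}\mu$. *)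

theory Defs
  imports "HOL-Library.FuncSet"
begin

(* A preordered set is given by its order relation r with Preorder r; reflexivity makes
   Field r its underlying set.  The empty preordered set (r = {}) is included. *)

definition monotone_map :: "'a rel \<Rightarrow> 'b rel \<Rightarrow> ('a \<Rightarrow> 'b) \<Rightarrow> bool" where
  "monotone_map X A R \<longleftrightarrow>
     R \<in> Field X \<rightarrow> Field A \<and>
     monotone_on (Field X) (\<lambda>x y. (x, y) \<in> X) (\<lambda>a b. (a, b) \<in> A) R"

(* 2^X: a monotone function from X to 2 = bool (False < True) is represented by the subset
   of Field X on which it is True, so that the pointwise order becomes inclusion. *)
definition two_pow :: "'a rel \<Rightarrow> 'a set set" where
  "two_pow X = {\<mu>. \<mu> \<subseteq> Field X \<and>
     monotone_on (Field X) (\<lambda>x y. (x, y) \<in> X) (\<le>) (\<lambda>x. x \<in> \<mu>)}"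

(* R^* on 2^A, i.e. precomposition with R, as a subset of Field X *)
definition pullback :: "'a rel \<Rightarrow> ('a \<Rightarrow> 'b) \<Rightarrow> 'b set \<Rightarrow> 'a set" where
  "pullback X R \<nu> = {x \<in> Field X. R x \<in> \<nu>}"

definition is_left_adjoint ::
  "'a set set \<Rightarrow> 'b set set \<Rightarrow> ('a set \<Rightarrow> 'b set) \<Rightarrow> ('b set \<Rightarrow> 'a set) \<Rightarrow> bool" where
  "is_left_adjoint P Q L G \<longleftrightarrow> L \<in> P \<rightarrow> Q \<and>
     (\<forall>\<mu>\<in>P. \<forall>\<nu>\<in>Q. L \<mu> \<subseteq> \<nu> \<longleftrightarrow> \<mu> \<subseteq> G \<nu>)"

definition is_right_adjoint ::
  "'a set set \<Rightarrow> 'b set set \<Rightarrow> ('a set \<Rightarrow> 'b set) \<Rightarrow> ('b set \<Rightarrow> 'a set) \<Rightarrow> bool" where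
  "is_right_adjoint P Q U G \<longleftrightarrow> U \<in> P \<rightarrow> Q \<and>
     (\<forall>\<mu>\<in>P. \<forall>\<nu>\<in>Q. \<nu> \<subseteq> U \<mu> \<longleftrightarrow> G \<nu> \<subseteq> \<mu>)"

(* The adjoints of R^*.  The adjunction fixes a HOL function only on two_pow X, hence the
   restriction to extensional functions; upper_approx_adjoint and lower_approx_adjoint
   below show that the descriptions are proper. *)
definition upper_approx :: "'a rel \<Rightarrow> 'b rel \<Rightarrow> ('a \<Rightarrow> 'b) \<Rightarrow> 'a set \<Rightarrow> 'b set" where
  "upper_approx X A R = (THE L. L \<in> extensional (two_pow X) \<and>
     is_left_adjoint (two_pow X) (two_pow A) L (pullback X R))"

definition lower_approx :: "'a rel \<Rightarrow> 'b rel \<Rightarrow> ('a \<Rightarrow> 'b) \<Rightarrow> 'a set \<Rightarrow> 'b set" where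
  "lower_approx X A R = (THE U. U \<in> extensional (two_pow X) \<and>
     is_right_adjoint (two_pow X) (two_pow A) U (pullback X R))"

(* B is reducible to B' along T with respect to S and \<mu>; meaningful for monotone maps
   S from X to B and T from B to B', and \<mu> in two_pow X *)
definition reducible_along ::
  "'x rel \<Rightarrow> 'b rel \<Rightarrow> 'c rel \<Rightarrow> ('b \<Rightarrow> 'c) \<Rightarrow> ('x \<Rightarrow> 'b) \<Rightarrow> 'x set \<Rightarrow> bool" where
  "reducible_along X B B' T S \<mu> \<longleftrightarrow>
     pullback B T (upper_approx X B' (T \<circ> S) \<mu>) = upper_approx X B S \<mu> \<and>
     pullback B T (lower_approx X B' (T \<circ> S) \<mu>) = lower_approx X B S \<mu>"

lemma two_pow_iff:
  "\<mu> \<in> two_pow X \<longleftrightarrow>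
     \<mu> \<subseteq> Field X \<and> (\<forall>x y. (x, y) \<in> X \<longrightarrow> x \<in> \<mu> \<longrightarrow> y \<in> \<mu>)"
proof -
  have "(\<forall>x\<in>Field X. \<forall>y\<in>Field X. (x, y) \<in> X \<longrightarrow> x \<in> \<mu> \<longrightarrow> y \<in> \<mu>) \<longleftrightarrow>
        (\<forall>x y. (x, y) \<in> X \<longrightarrow> x \<in> \<mu> \<longrightarrow> y \<in> \<mu>)"
    by (meson FieldI1 FieldI2)
  then show ?thesis by (simp add: two_pow_def monotone_on_def)
qed

lemma two_pow_Inter:
  assumes "\<F> \<subseteq> two_pow A"
  shows "\<Inter>\<F> \<inter> Field A \<in> two_pow A"
  unfolding two_pow_iff
proof (intro conjI allI impI)
  fix x y assume xy: "(x, y) \<in> A" and x: "x \<in> \<Inter>\<F> \<inter> Field A"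
  have "y \<in> \<nu>" if "\<nu> \<in> \<F>" for \<nu>
  proof -
    have "\<nu> \<in> two_pow A" using assms that by (rule subsetD)
    moreover have "x \<in> \<nu>" using x that by simp
    ultimately show ?thesis using xy unfolding two_pow_iff by simp
  qed
  then show "y \<in> \<Inter>\<F> \<inter> Field A" using xy by (simp add: FieldI2)
qed simp

lemma two_pow_Union:
  assumes "\<F> \<subseteq> two_pow A"
  shows "\<Union>\<F> \<in> two_pow A"
  unfolding two_pow_iff
proof (intro conjI allI impI)
  show "\<Union>\<F> \<subseteq> Field A"
  proof (rule Union_least)
    fix \<nu> assume "\<nu> \<in> \<F>"
    with assms have "\<nu> \<in> two_pow A" by (rule subsetD)
    then show "\<nu> \<subseteq> Field A" by (simp add: two_pow_iff)
  qed
  fix x y assume xy: "(x, y) \<in> A" and "x \<in> \<Union>\<F>"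
  then obtain \<nu> where \<nu>: "\<nu> \<in> \<F>" "x \<in> \<nu>" by (elim UnionE)
  have "\<nu> \<in> two_pow A" using assms \<nu>(1) by (rule subsetD)
  then have "y \<in> \<nu>" using xy \<nu>(2) unfolding two_pow_iff by simp
  then show "y \<in> \<Union>\<F>" using \<nu>(1) by (rule UnionI[rotated])
qed

lemma left_adjoint_unique:
  assumes "is_left_adjoint P Q L G" "is_left_adjoint P Q L' G" "\<mu> \<in> P"
  shows "L \<mu> = L' \<mu>"
proof -
  have Q: "L \<mu> \<in> Q" "L' \<mu> \<in> Q"
    using assms by (auto simp: is_left_adjoint_def)
  have 1: "L \<mu> \<subseteq> \<nu> \<longleftrightarrow> \<mu> \<subseteq> G \<nu>" if "\<nu> \<in> Q" for \<nu>
    using assms(1,3) that unfolding is_left_adjoint_def by simp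
  have 2: "L' \<mu> \<subseteq> \<nu> \<longleftrightarrow> \<mu> \<subseteq> G \<nu>" if "\<nu> \<in> Q" for \<nu>
    using assms(2,3) that unfolding is_left_adjoint_def by simp
  show ?thesis
    using 1[OF Q(1)] 1[OF Q(2)] 2[OF Q(1)] 2[OF Q(2)] by simp
qed

lemma right_adjoint_unique:
  assumes "is_right_adjoint P Q U G" "is_right_adjoint P Q U' G" "\<mu> \<in> P"
  shows "U \<mu> = U' \<mu>"
proof -
  have Q: "U \<mu> \<in> Q" "U' \<mu> \<in> Q"
    using assms by (auto simp: is_right_adjoint_def)
  have 1: "\<nu> \<subseteq> U \<mu> \<longleftrightarrow> G \<nu> \<subseteq> \<mu>" if "\<nu> \<in> Q" for \<nu>
    using assms(1,3) that unfolding is_right_adjoint_def by simp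
  have 2: "\<nu> \<subseteq> U' \<mu> \<longleftrightarrow> G \<nu> \<subseteq> \<mu>" if "\<nu> \<in> Q" for \<nu>
    using assms(2,3) that unfolding is_right_adjoint_def by simp
  show ?thesis
    using 1[OF Q(1)] 1[OF Q(2)] 2[OF Q(1)] 2[OF Q(2)] by simp
qed

lemma upper_approx_adjoint:
  assumes "monotone_map X A R"
  shows "is_left_adjoint (two_pow X) (two_pow A) (upper_approx X A R) (pullback X R)"
proof -
  define L where "L = restrict
    (\<lambda>\<mu>. \<Inter>{\<nu> \<in> two_pow A. \<mu> \<subseteq> pullback X R \<nu>} \<inter> Field A) (two_pow X)"
  have "L \<mu> \<in> two_pow A" if "\<mu> \<in> two_pow X" for \<mu>
    using that two_pow_Inter[of "{\<nu> \<in> two_pow A. \<mu> \<subseteq> pullback X R \<nu>}" A]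
    by (simp add: L_def)
  moreover have "L \<mu> \<subseteq> \<nu> \<longleftrightarrow> \<mu> \<subseteq> pullback X R \<nu>" if "\<mu> \<in> two_pow X" "\<nu> \<in> two_pow A" for \<mu> \<nu>
  proof
    assume *: "L \<mu> \<subseteq> \<nu>"
    show "\<mu> \<subseteq> pullback X R \<nu>"
    proof
      fix x assume x: "x \<in> \<mu>"
      then have X: "x \<in> Field X" using that(1) by (auto simp: two_pow_def)
      then have "R x \<in> Field A" using assms by (auto simp: monotone_map_def)
      then have "R x \<in> L \<mu>" using x that(1) by (auto simp: L_def pullback_def)
      then show "x \<in> pullback X R \<nu>" using * X by (auto simp: pullback_def)
    qed
  next
    assume "\<mu> \<subseteq> pullback X R \<nu>"
    then show "L \<mu> \<subseteq> \<nu>" using that by (auto simp: L_def)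
  qed
  ultimately have L: "L \<in> extensional (two_pow X) \<and>
      is_left_adjoint (two_pow X) (two_pow A) L (pullback X R)"
    by (simp add: is_left_adjoint_def L_def)
  have "L' = L" if "L' \<in> extensional (two_pow X) \<and>
      is_left_adjoint (two_pow X) (two_pow A) L' (pullback X R)" for L'
    proof (rule extensionalityI[where A = "two_pow X"])
    show "L' \<in> extensional (two_pow X)" "L \<in> extensional (two_pow X)"
      using that L by blast+
    show "L' \<mu> = L \<mu>" if "\<mu> \<in> two_pow X" for \<mu>
      using left_adjoint_unique[OF conjunct2[OF \<open>L' \<in> _ \<and> _\<close>] conjunct2[OF L] that] .
  qed
  then have "upper_approx X A R = L"
    unfolding upper_approx_def using L by (intro the_equality)
  then show ?thesis using L by simp
qed

lemma lower_approx_adjoint: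
  assumes "monotone_map X A R"
  shows "is_right_adjoint (two_pow X) (two_pow A) (lower_approx X A R) (pullback X R)"
proof -
  define U where "U = restrict
    (\<lambda>\<mu>. \<Union>{\<nu> \<in> two_pow A. pullback X R \<nu> \<subseteq> \<mu>}) (two_pow X)"
  have "U \<mu> \<in> two_pow A" if "\<mu> \<in> two_pow X" for \<mu>
    using that two_pow_Union[of "{\<nu> \<in> two_pow A. pullback X R \<nu> \<subseteq> \<mu>}" A]
    by (simp add: U_def)
  moreover have "\<nu> \<subseteq> U \<mu> \<longleftrightarrow> pullback X R \<nu> \<subseteq> \<mu>" if "\<mu> \<in> two_pow X" "\<nu> \<in> two_pow A" for \<mu> \<nu>
  proof
    assume "\<nu> \<subseteq> U \<mu>"
    then show "pullback X R \<nu> \<subseteq> \<mu>" using that(1) by (auto simp: U_def pullback_def)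
  next
    assume "pullback X R \<nu> \<subseteq> \<mu>"
    then show "\<nu> \<subseteq> U \<mu>" using that by (auto simp: U_def)
  qed
  ultimately have U: "U \<in> extensional (two_pow X) \<and>
      is_right_adjoint (two_pow X) (two_pow A) U (pullback X R)"
    by (simp add: is_right_adjoint_def U_def)
  have "U' = U" if "U' \<in> extensional (two_pow X) \<and>
      is_right_adjoint (two_pow X) (two_pow A) U' (pullback X R)" for U'
    proof (rule extensionalityI[where A = "two_pow X"])
    show "U' \<in> extensional (two_pow X)" "U \<in> extensional (two_pow X)"
      using that U by blast+
    show "U' \<mu> = U \<mu>" if "\<mu> \<in> two_pow X" for \<mu>
      using right_adjoint_unique[OF conjunct2[OF \<open>U' \<in> _ \<and> _\<close>] conjunct2[OF U] that] .
  qed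
  then have "lower_approx X A R = U"
    unfolding lower_approx_def using U by (intro the_equality)
  then show ?thesis using U by simp
qed

end

theory Submission
  imports Defs
begin

text \<open>Pullback is contravariantly functorial: pulling an approximation on \<open>A''\<close>
  back along \<open>R'' \<circ> R'\<close> means pulling it back to \<open>A'\<close>, then to
  \<open>A\<close>. The second reducibility hypothesis evaluates the first stage, the first one the
  second stage, alike for upper and lower approximations.\<close>

lemma pullback_comp:
  assumes "S \<in> Field X \<rightarrow> Field A"
  shows "pullback X (T \<circ> S) \<nu> = pullback X S (pullback A T \<nu>)"
  using assms by (auto simp: pullback_def)

theorem theorem5:
  fixes X :: "'x rel" and A :: "'a rel" and A' :: "'b rel" and A'' :: "'c rel"
    and R :: "'x \<Rightarrow> 'a" and R' :: "'a \<Rightarrow> 'b" and R'' :: "'b \<Rightarrow> 'c" and \<mu> :: "'x set"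
  assumes "Preorder X" and "Preorder A" and "Preorder A'" and "Preorder A''"
    and "monotone_map X A R" and "monotone_map A A' R'" and "monotone_map A' A'' R''"
    and "\<mu> \<in> two_pow X"
    and "reducible_along X A A' R' R \<mu>"
    and "reducible_along X A' A'' R'' (R' \<circ> R) \<mu>"
  shows "reducible_along X A A'' (R'' \<circ> R') R \<mu>"
proof -
  \<comment> \<open>\<open>pullback A' R''\<close> keeps only points of \<open>Field A'\<close>, so
    splitting the pullback requires \<open>R'\<close> to land there.\<close>
  have "R' \<in> Field A \<rightarrow> Field A'"
    using assms(6) by (simp add: monotone_map_def)
  then show ?thesis
    \<comment> \<open>Associativity turns \<open>(R'' \<circ> R') \<circ> R\<close> into
      \<open>R'' \<circ> (R' \<circ> R)\<close>, the map in the second hypothesis.\<close>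
    using assms(9,10) by (simp add: reducible_along_def pullback_comp comp_assoc)
qed

end
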